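(* There exist finite compactly supported Borel measures on a Euclidean space (that is, a dimension $d\ge 1$ and a finite compactly supported Borel measure $\mu$ on $\mathbb{R}^d$) that do not admit any frame measure.
   Context: For a finite Borel measure $\mu$ on $\mathbb{R}^d$ and $f\in L^1(\mu)$, put $\widehat{f\,d\mu}(t)=\int f(x)e^{-2\pi i t\cdot x}\,d\mu(x)$, $t\in\mathbb{R}^d$. A (nonnegative) Borel measure $\nu$ on $\mathbb{R}^d$ is a frame measure for $\mu$ if there exist constants $A,B>0$ such that $A\|f\|_{L^2(\mu)}^2\le \|\widehat{f\,d\mu}\|_{L^2(\nu)}^2\le B\|f\|_{L^2(\mu)}^2$ for every $f\in L^2(\mu)$. *)

theory Defs
  imports "HOL-Analysis.Analysis"
begin

text \<open>
  The dimension is quantified existentially in the theorem, so it cannot be a type. We work in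
  the library's \<^const>\<open>Euclidean_space\<close> \<open>d\<close>, whose points are the functions \<open>nat \<Rightarrow> real\<close>
  vanishing at all indices \<open>i \<ge> d\<close>, with the topology of coordinatewise convergence.
\<close>

definition borel_Rd :: "nat \<Rightarrow> (nat \<Rightarrow> real) measure" where
  "borel_Rd d = sigma (topspace (Euclidean_space d)) {U. openin (Euclidean_space d) U}"

definition borel_measure_on_Rd :: "nat \<Rightarrow> (nat \<Rightarrow> real) measure \<Rightarrow> bool" where
  "borel_measure_on_Rd d \<mu> \<longleftrightarrow> sets \<mu> = sets (borel_Rd d)"

definition measure_support :: "nat \<Rightarrow> (nat \<Rightarrow> real) measure \<Rightarrow> (nat \<Rightarrow> real) set" where
  "measure_support d \<mu> = {x \<in> topspace (Euclidean_space d).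
     \<forall>U. openin (Euclidean_space d) U \<and> x \<in> U \<longrightarrow> emeasure \<mu> U > 0}"

definition compactly_supported :: "nat \<Rightarrow> (nat \<Rightarrow> real) measure \<Rightarrow> bool" where
  "compactly_supported d \<mu> \<longleftrightarrow> compactin (Euclidean_space d) (measure_support d \<mu>)"

definition dot_Rd :: "nat \<Rightarrow> (nat \<Rightarrow> real) \<Rightarrow> (nat \<Rightarrow> real) \<Rightarrow> real" where
  "dot_Rd d t x = (\<Sum>i<d. t i * x i)"

definition fourier_transform ::
    "nat \<Rightarrow> (nat \<Rightarrow> real) measure \<Rightarrow> ((nat \<Rightarrow> real) \<Rightarrow> complex) \<Rightarrow> (nat \<Rightarrow> real) \<Rightarrow> complex" where
  "fourier_transform d \<mu> f t =
     (LINT x|\<mu>. f x * exp (- 2 * of_real pi * \<i> * of_real (dot_Rd d t x)))"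

text \<open>The squared \<open>L\<^sup>2\<close> norm takes values in \<open>[0, \<infinity>]\<close>: for a function not in \<open>L\<^sup>2\<close> it is \<open>\<infinity>\<close>.\<close>

definition L2_norm_sq :: "'a measure \<Rightarrow> ('a \<Rightarrow> complex) \<Rightarrow> ennreal" where
  "L2_norm_sq M f = (\<integral>\<^sup>+x. ennreal ((cmod (f x))\<^sup>2) \<partial>M)"

definition L2_space :: "'a measure \<Rightarrow> ('a \<Rightarrow> complex) set" where
  "L2_space M = {f \<in> borel_measurable M. L2_norm_sq M f < \<infinity>}"

definition frame_measure :: "nat \<Rightarrow> (nat \<Rightarrow> real) measure \<Rightarrow> (nat \<Rightarrow> real) measure \<Rightarrow> bool" where
  "frame_measure d \<mu> \<nu> \<longleftrightarrow> borel_measure_on_Rd d \<nu> \<and>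
     (\<exists>A B :: real. A > 0 \<and> B > 0 \<and>
        (\<forall>f \<in> L2_space \<mu>.
           ennreal A * L2_norm_sq \<mu> f \<le> L2_norm_sq \<nu> (fourier_transform d \<mu> f) \<and>
           L2_norm_sq \<nu> (fourier_transform d \<mu> f) \<le> ennreal B * L2_norm_sq \<mu> f))"

end

theory Submission
  imports Defs
begin

text \<open>
  A measure with infinitely many atoms has no frame measure. If \<open>x\<close> is an atom of mass \<open>m\<close>, then
  the Fourier transform of the indicator of \<open>{x}\<close> has constant modulus \<open>m\<close>, so that a frame
  measure \<open>\<nu>\<close> of total mass \<open>N\<close> satisfies \<open>A m \<le> m\<^sup>2 N \<le> B m\<close>. The upper bound at a single atom
  forces \<open>N < \<infinity>\<close>, and then the lower bound gives \<open>m \<ge> A / N\<close> at every atom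
  (\<open>frame_measure_atoms_bounded_below\<close>). A finite measure with infinitely many atoms has atoms
  of arbitrarily small mass. The example below puts mass \<open>(1/2)\<^bsup>n+1\<^esup>\<close> at the point \<open>1/(n+1)\<close> of the
  real line; its support lies in the unit interval.
\<close>

section \<open>Atoms and frame measures\<close>

lemma space_borel_measure_on_Rd:
  assumes "borel_measure_on_Rd d \<mu>"
  shows "space \<mu> = topspace (Euclidean_space d)"
proof -
  have "{U. openin (Euclidean_space d) U} \<subseteq> Pow (topspace (Euclidean_space d))"
    by (auto dest: openin_subset)
  then have "space (borel_Rd d) = topspace (Euclidean_space d)"
    by (simp add: borel_Rd_def space_measure_of_conv)
  with assms show ?thesis
    unfolding borel_measure_on_Rd_def by (metis sets_eq_imp_space_eq)
qed

lemma openin_sets_borel_Rd: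
  assumes "openin (Euclidean_space d) U"
  shows "U \<in> sets (borel_Rd d)"
proof -
  have "{U. openin (Euclidean_space d) U} \<subseteq> Pow (topspace (Euclidean_space d))"
    by (auto dest: openin_subset)
  with assms show ?thesis
    by (simp add: borel_Rd_def sigma_sets.Basic)
qed

lemma closedin_sets_borel_Rd:
  assumes "closedin (Euclidean_space d) C"
  shows "C \<in> sets (borel_Rd d)"
proof -
  have "C = topspace (Euclidean_space d) - (topspace (Euclidean_space d) - C)"
    using closedin_subset[OF assms] by blast
  moreover have "topspace (Euclidean_space d) - C \<in> sets (borel_Rd d)"
    using assms by (intro openin_sets_borel_Rd) (simp add: closedin_def)
  moreover have "topspace (Euclidean_space d) \<in> sets (borel_Rd d)"
    by (intro openin_sets_borel_Rd) simp
  ultimately show ?thesis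
    by (metis sets.Diff)
qed

lemma Hausdorff_Euclidean_space: "Hausdorff_space (Euclidean_space d)"
  unfolding Euclidean_space_def
  by (intro Hausdorff_space_subtopology) (simp add: Hausdorff_space_product_topology)

lemma singleton_sets_borel_Rd:
  assumes "x \<in> topspace (Euclidean_space d)"
  shows "{x} \<in> sets (borel_Rd d)"
  by (intro closedin_sets_borel_Rd closedin_Hausdorff_sing_eq[THEN iffD2]
        Hausdorff_Euclidean_space assms)

lemma L2_norm_sq_indicator_singleton:
  assumes "{x} \<in> sets M"
  shows "L2_norm_sq M (indicator {x}) = emeasure M {x}"
proof -
  have "L2_norm_sq M (indicator {x}) = (\<integral>\<^sup>+y. indicator {x} y \<partial>M)"
    unfolding L2_norm_sq_def by (intro nn_integral_cong) (simp add: indicator_def)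
  with assms show ?thesis by simp
qed

text \<open>The integrand is supported at \<open>x\<close>, where the exponential is a unimodular constant.\<close>

lemma cmod_fourier_transform_indicator_singleton:
  assumes "finite_measure \<mu>" "{x} \<in> sets \<mu>"
  shows "cmod (fourier_transform d \<mu> (indicator {x}) t) = measure \<mu> {x}"
proof -
  define c where "c = exp (- 2 * of_real pi * \<i> * of_real (dot_Rd d t x))"
  have "fourier_transform d \<mu> (indicator {x}) t = (LINT y|\<mu>. indicator {x} y *\<^sub>R c)"
    unfolding fourier_transform_def c_def
    by (intro Bochner_Integration.integral_cong) (auto simp: indicator_def)
  also have "\<dots> = measure \<mu> {x} *\<^sub>R c"
    using assms sets.sets_into_space[OF assms(2)]
    by (subst integral_scaleR_left)
       (auto simp: finite_measure.emeasure_eq_measure Int_absorb2 intro!: integrable_real_indicator)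
  finally show ?thesis
    by (simp add: c_def norm_exp_eq_Re)
qed

lemma frame_measure_atoms_bounded_below:
  assumes "frame_measure d \<mu> \<nu>" "finite_measure \<mu>"
  obtains c :: real where "c > 0"
    "\<And>x. {x} \<in> sets \<mu> \<Longrightarrow> measure \<mu> {x} > 0 \<Longrightarrow> c \<le> measure \<mu> {x}"
proof -
  interpret finite_measure \<mu> by fact
  define N where "N = emeasure \<nu> (space \<nu>)"
  obtain A B :: real where AB: "A > 0" "B > 0"
    and frame: "\<And>f. f \<in> L2_space \<mu> \<Longrightarrow>
      ennreal A * L2_norm_sq \<mu> f \<le> L2_norm_sq \<nu> (fourier_transform d \<mu> f) \<and>
      L2_norm_sq \<nu> (fourier_transform d \<mu> f) \<le> ennreal B * L2_norm_sq \<mu> f"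
    using assms(1) unfolding frame_measure_def by blast
  have atom: "ennreal (A * measure \<mu> {x}) \<le> ennreal ((measure \<mu> {x})\<^sup>2) * N"
    "ennreal ((measure \<mu> {x})\<^sup>2) * N \<le> ennreal (B * measure \<mu> {x})"
    if x: "{x} \<in> sets \<mu>" for x
  proof -
    have "indicator {x} \<in> L2_space \<mu>"
      using x by (simp add: L2_space_def L2_norm_sq_indicator_singleton emeasure_eq_measure)
    from frame[OF this] have
      "ennreal A * emeasure \<mu> {x} \<le> ennreal ((measure \<mu> {x})\<^sup>2) * N"
      "ennreal ((measure \<mu> {x})\<^sup>2) * N \<le> ennreal B * emeasure \<mu> {x}"
      by (simp_all add: L2_norm_sq_indicator_singleton x N_def
          L2_norm_sq_def[of \<nu>] cmod_fourier_transform_indicator_singleton[OF assms(2) x])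
    then show "ennreal (A * measure \<mu> {x}) \<le> ennreal ((measure \<mu> {x})\<^sup>2) * N"
      "ennreal ((measure \<mu> {x})\<^sup>2) * N \<le> ennreal (B * measure \<mu> {x})"
      using AB by (simp_all add: emeasure_eq_measure ennreal_mult)
  qed
  show thesis
  proof (cases "N = \<infinity>")
    case True
    \<comment> \<open>No atom can satisfy the upper frame bound, so any constant serves.\<close>
    have "measure \<mu> {x} \<le> 0" if "{x} \<in> sets \<mu>" for x
    proof (rule ccontr)
      assume "\<not> measure \<mu> {x} \<le> 0"
      then have "ennreal ((measure \<mu> {x})\<^sup>2) * N = \<infinity>"
        using True by (simp add: ennreal_mult_top)
      with atom(2)[OF that] show False
        by (simp add: top_unique)
    qed
    then show thesis
      using that[of 1] by (metis not_less zero_less_one)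
  next
    case False
    then obtain n where n: "n \<ge> 0" "N = ennreal n"
      by (cases N) auto
    show thesis
    proof (rule that)
      \<comment> \<open>The denominator \<open>n + 1\<close> instead of \<open>n\<close> covers the case \<open>n = 0\<close>.\<close>
      show "A / (n + 1) > 0"
        using AB n by simp
      fix x assume x: "{x} \<in> sets \<mu>" and pos: "measure \<mu> {x} > 0"
      let ?m = "measure \<mu> {x}"
      have "ennreal (A * ?m) \<le> ennreal (?m\<^sup>2 * n)"
        using atom(1)[OF x] n by (simp add: ennreal_mult)
      then have "A * ?m \<le> (?m * n) * ?m"
        using n by (simp add: power2_eq_square mult_ac)
      then have "A \<le> ?m * n"
        using pos by (simp add: mult.commute)
      also have "\<dots> \<le> ?m * (n + 1)"
        using pos by simp
      finally show "A / (n + 1) \<le> ?m"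
        using n by (simp add: field_simps)
    qed
  qed
qed

section \<open>Supports\<close>

text \<open>
  A point outside the support has a null open neighbourhood, and no point of that neighbourhood
  lies in the support. So the support is closed, and it is contained in every closed set with a
  null complement.
\<close>

lemma compactly_supportedI:
  assumes K: "compactin (Euclidean_space d) K"
    and null: "emeasure \<mu> (topspace (Euclidean_space d) - K) = 0"
  shows "compactly_supported d \<mu>"
proof -
  let ?E = "Euclidean_space d"
  have "openin ?E (topspace ?E - measure_support d \<mu>)"
  proof (subst openin_subopen, safe)
    fix x assume "x \<in> topspace ?E" "x \<notin> measure_support d \<mu>"
    then obtain U where U: "openin ?E U" "x \<in> U" "\<not> emeasure \<mu> U > 0"
      unfolding measure_support_def by auto
    then have "U \<subseteq> topspace ?E - measure_support d \<mu>"
      unfolding measure_support_def using openin_subset by fastforce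
    with U show "\<exists>T. openin ?E T \<and> x \<in> T \<and> T \<subseteq> topspace ?E - measure_support d \<mu>"
      by blast
  qed
  then have closed: "closedin ?E (measure_support d \<mu>)"
    by (auto simp: closedin_def measure_support_def)
  have "openin ?E (topspace ?E - K)"
    using compactin_imp_closedin[OF Hausdorff_Euclidean_space K] by (simp add: closedin_def)
  with null have "measure_support d \<mu> \<subseteq> K"
    unfolding measure_support_def by fastforce
  with K closed show ?thesis
    unfolding compactly_supported_def by (blast intro: closed_compactin)
qed

section \<open>A finite measure with infinitely many atoms\<close>

definition line_point :: "real \<Rightarrow> nat \<Rightarrow> real" where
  "line_point r = (\<lambda>i. if i = 0 then r else 0)"

definition atomic_measure :: "(nat \<Rightarrow> real) measure" where
  "atomic_measure =
     distr (density (count_space UNIV) (\<lambda>n. ennreal ((1/2) ^ Suc n))) (borel_Rd 1)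
       (\<lambda>n. line_point (1 / real (Suc n)))"

lemma line_point_eq_iff: "line_point r = line_point s \<longleftrightarrow> r = s"
  by (auto simp: line_point_def fun_eq_iff)

lemma line_point_in_topspace: "line_point r \<in> topspace (Euclidean_space 1)"
  by (simp add: line_point_def topspace_Euclidean_space)

lemma continuous_map_line_point: "continuous_map euclideanreal (Euclidean_space 1) line_point"
  unfolding Euclidean_space_def continuous_map_in_subtopology
proof
  show "continuous_map euclideanreal (powertop_real UNIV) line_point"
    unfolding continuous_map_componentwise_UNIV
  proof
    fix k :: nat
    show "continuous_map euclideanreal euclideanreal (\<lambda>r. line_point r k)"
      by (cases "k = 0") (simp_all add: line_point_def)
  qed
qed (auto simp: line_point_def)

lemma borel_measure_on_Rd_atomic_measure: "borel_measure_on_Rd 1 atomic_measure"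
  by (simp add: borel_measure_on_Rd_def atomic_measure_def)

lemma emeasure_atomic_measure:
  assumes "S \<in> sets (borel_Rd 1)"
  shows "emeasure atomic_measure S =
    (\<Sum>n. ennreal ((1/2) ^ Suc n) * indicator S (line_point (1 / real (Suc n))))"
proof -
  let ?M = "density (count_space UNIV) (\<lambda>n. ennreal ((1/2) ^ Suc n))"
  let ?g = "\<lambda>n. line_point (1 / real (Suc n))"
  have "space (borel_Rd 1) = topspace (Euclidean_space 1)"
    by (rule space_borel_measure_on_Rd) (simp add: borel_measure_on_Rd_def)
  then have "?g \<in> measurable ?M (borel_Rd 1)"
    using line_point_in_topspace by (auto simp: measurable_def)
  then have "emeasure atomic_measure S = emeasure ?M (?g -` S)"
    using assms by (simp add: atomic_measure_def emeasure_distr)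
  also have "\<dots> = (\<integral>\<^sup>+n. ennreal ((1/2) ^ Suc n) * indicator (?g -` S) n \<partial>count_space UNIV)"
    by (simp add: emeasure_density)
  also have "\<dots> = (\<Sum>n. ennreal ((1/2) ^ Suc n) * indicator S (?g n))"
    by (simp add: nn_integral_count_space_nat indicator_def)
  finally show ?thesis .
qed

lemma finite_measure_atomic_measure: "finite_measure atomic_measure"
proof
  have "emeasure atomic_measure (space atomic_measure) \<le> (\<Sum>n. ennreal ((1/2) ^ Suc n))"
    using borel_measure_on_Rd_atomic_measure
    by (subst emeasure_atomic_measure)
       (auto simp: borel_measure_on_Rd_def indicator_def intro!: suminf_le)
  also have "\<dots> = ennreal 1"
    by (intro suminf_ennreal_eq power_half_series) simp
  finally show "emeasure atomic_measure (space atomic_measure) \<noteq> \<infinity>"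
    by (auto simp: top_unique)
qed

lemma measure_atomic_measure_singleton:
  "measure atomic_measure {line_point (1 / real (Suc n))} = (1/2) ^ Suc n"
proof -
  have "emeasure atomic_measure {line_point (1 / real (Suc n))} =
      (\<Sum>k. ennreal ((1/2) ^ Suc k) * indicator {n} k)"
    using singleton_sets_borel_Rd line_point_in_topspace
    by (subst emeasure_atomic_measure)
       (auto simp: indicator_def line_point_eq_iff intro!: suminf_cong)
  also have "\<dots> = ennreal ((1/2) ^ Suc n)"
    by (subst suminf_finite[of "{n}"]) auto
  finally show ?thesis
    by (simp add: measure_def del: power_Suc)
qed

lemma compactly_supported_atomic_measure: "compactly_supported 1 atomic_measure"
proof (rule compactly_supportedI)
  let ?K = "line_point ` {0..1}"
  show K: "compactin (Euclidean_space 1) ?K"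
    by (rule image_compactin[OF _ continuous_map_line_point]) simp
  have "line_point (1 / real (Suc n)) \<in> ?K" for n
    by (intro imageI) simp
  then show "emeasure atomic_measure (topspace (Euclidean_space 1) - ?K) = 0"
    using compactin_imp_closedin[OF Hausdorff_Euclidean_space K]
    by (subst emeasure_atomic_measure) (auto simp: closedin_def intro!: openin_sets_borel_Rd)
qed

theorem theorem2p2:
  shows "\<exists>(d::nat) (\<mu> :: (nat \<Rightarrow> real) measure).
    d \<ge> 1 \<and> borel_measure_on_Rd d \<mu> \<and> finite_measure \<mu> \<and> compactly_supported d \<mu> \<and>
    \<not> (\<exists>\<nu>. frame_measure d \<mu> \<nu>)"
proof (intro exI conjI notI)
  show "(1::nat) \<ge> 1" by simp
  show "borel_measure_on_Rd 1 atomic_measure"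
    by (rule borel_measure_on_Rd_atomic_measure)
  show "finite_measure atomic_measure"
    by (rule finite_measure_atomic_measure)
  show "compactly_supported 1 atomic_measure"
    by (rule compactly_supported_atomic_measure)
  assume "\<exists>\<nu>. frame_measure 1 atomic_measure \<nu>"
  then obtain c :: real where c: "c > 0"
    "\<And>x. {x} \<in> sets atomic_measure \<Longrightarrow> measure atomic_measure {x} > 0
      \<Longrightarrow> c \<le> measure atomic_measure {x}"
    using frame_measure_atoms_bounded_below finite_measure_atomic_measure by blast
  obtain n where n: "(1/2) ^ n < c"
    using real_arch_pow_inv[OF c(1), of "1/2"] by auto
  have "{line_point (1 / real (Suc n))} \<in> sets atomic_measure"
    using singleton_sets_borel_Rd[OF line_point_in_topspace] borel_measure_on_Rd_atomic_measure
    by (simp add: borel_measure_on_Rd_def)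
  from c(2)[OF this] have "c \<le> (1/2) ^ Suc n"
    by (simp add: measure_atomic_measure_singleton del: power_Suc of_nat_Suc)
  also have "\<dots> \<le> (1/2) ^ n"
    by (rule power_decreasing) auto
  finally show False
    using n by simp
qed

end
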